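(* Let $n$ be an odd positive integer and let $\mathcal{R}_n$ be the dihedral quandle on $\mathbb{Z}_n$. Then the set of idempotents of the integral quandle ring $\mathbb{Z}[\mathcal{R}_n]$, i.e. the set of elements $u\in\mathbb{Z}[\mathcal{R}_n]$ with $u^2=u$, is exactly $\{0\}\cup\{e_x : x\in \mathcal{R}_n\}$.
   Context: The dihedral quandle $\mathcal{R}_n$ is the set $\mathbb{Z}_n=\mathbb{Z}/n\mathbb{Z}$ with the binary operation $x\triangleright y = 2y-x$. The integral quandle ring $\mathbb{Z}[\mathcal{R}_n]$ is the (in general nonassociative, non-unital) ring whose additive group is the free $\mathbb{Z}$-module with basis $\{e_x : x\in\mathbb{Z}_n\}$, with multiplication defined by bilinear extension of $e_x e_y = e_{x\triangleright y}=e_{2y-x}$. *)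

theory Defs
  imports "HOL-Algebra.Free_Abelian_Groups"
begin

definition quandle :: "'a set \<Rightarrow> ('a \<Rightarrow> 'a \<Rightarrow> 'a) \<Rightarrow> bool" where
  "quandle S op \<longleftrightarrow>
     (\<forall>x\<in>S. \<forall>y\<in>S. op x y \<in> S) \<and>
     (\<forall>x\<in>S. op x x = x) \<and>
     (\<forall>y\<in>S. bij_betw (\<lambda>x. op x y) S S) \<and>
     (\<forall>x\<in>S. \<forall>y\<in>S. \<forall>z\<in>S. op (op x y) z = op (op x z) (op y z))"

(* Z_n is represented by the residues 0, ..., n - 1. *)

definition dihedral_carrier :: "nat \<Rightarrow> int set" where
  "dihedral_carrier n = {0..<int n}"

definition dihedral_op :: "nat \<Rightarrow> int \<Rightarrow> int \<Rightarrow> int" where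
  "dihedral_op n x y = (2 * y - x) mod int n"

(* The additive group of the integral quandle ring of (S, op) is free_Abelian_group S, whose
   elements are the finitely supported integer-valued functions with support in S and whose
   basis element e_x is frag_of x.  As the ring is nonassociative and non-unital, no
   HOL-Algebra ring record is used; the product is the bilinear extension of op. *)

definition quandle_ring_mult ::
  "('a \<Rightarrow> 'a \<Rightarrow> 'a) \<Rightarrow> ('a \<Rightarrow>\<^sub>0 int) \<Rightarrow> ('a \<Rightarrow>\<^sub>0 int) \<Rightarrow> ('a \<Rightarrow>\<^sub>0 int)" where
  "quandle_ring_mult op u v = frag_extend (\<lambda>x. frag_extend (\<lambda>y. frag_of (op x y)) v) u"

definition quandle_ring_idempotents ::
  "'a set \<Rightarrow> ('a \<Rightarrow> 'a \<Rightarrow> 'a) \<Rightarrow> ('a \<Rightarrow>\<^sub>0 int) set" where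
  "quandle_ring_idempotents S op =
     {u \<in> carrier (free_Abelian_group S). quandle_ring_mult op u u = u}"

lemma quandle_dihedral:
  assumes "n > 0"
  shows "quandle (dihedral_carrier n) (dihedral_op n)"
proof -
  have inv: "dihedral_op n (dihedral_op n x y) y = x" if "x \<in> dihedral_carrier n" for x y
    using that by (simp add: dihedral_op_def dihedral_carrier_def mod_diff_right_eq)
  have closed: "dihedral_op n x y \<in> dihedral_carrier n" for x y
    using assms by (simp add: dihedral_op_def dihedral_carrier_def)
  have "bij_betw (\<lambda>x. dihedral_op n x y) (dihedral_carrier n) (dihedral_carrier n)" for y
    by (rule bij_betw_byWitness[where f' = "\<lambda>x. dihedral_op n x y"]) (auto simp: inv closed)
  moreover have "dihedral_op n (dihedral_op n x y) z =
      dihedral_op n (dihedral_op n x z) (dihedral_op n y z)" for x y z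
  proof -
    have "dihedral_op n (dihedral_op n x y) z = (2 * z - (2 * y - x)) mod int n"
      by (simp add: dihedral_op_def mod_diff_right_eq)
    also have "2 * z - (2 * y - x) = 2 * (2 * z - y) - (2 * z - x)"
      by simp
    also have "(2 * (2 * z - y) - (2 * z - x)) mod int n =
        dihedral_op n (dihedral_op n x z) (dihedral_op n y z)"
      unfolding dihedral_op_def by (intro mod_diff_cong) (simp_all only: mod_mult_right_eq mod_mod_trivial)
    finally show ?thesis .
  qed
  moreover have "dihedral_op n x x = x" if "x \<in> dihedral_carrier n" for x
    using that by (simp add: dihedral_op_def dihedral_carrier_def)
  ultimately show ?thesis
    unfolding quandle_def using closed by blast
qed

lemma quandle_ring_mult_frag_of [simp]:
  "quandle_ring_mult op (frag_of x) (frag_of y) = frag_of (op x y)"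
  by (simp add: quandle_ring_mult_def)

lemma quandle_ring_mult_add_left:
  "quandle_ring_mult op (u + v) w = quandle_ring_mult op u w + quandle_ring_mult op v w"
  by (simp add: quandle_ring_mult_def frag_extend_add)

lemma quandle_ring_mult_add_right:
  "quandle_ring_mult op u (v + w) = quandle_ring_mult op u v + quandle_ring_mult op u w"
  by (simp add: quandle_ring_mult_def frag_extend_add)
     (simp add: frag_extend_def frag_cmul_distrib2 sum.distrib)

lemma quandle_ring_mult_closed:
  assumes "quandle S op" "u \<in> carrier (free_Abelian_group S)" "v \<in> carrier (free_Abelian_group S)"
  shows "quandle_ring_mult op u v \<in> carrier (free_Abelian_group S)"
proof -
  have *: "Poly_Mapping.keys (frag_extend (\<lambda>y. frag_of (op x y)) v) \<subseteq> S" if "x \<in> S" for x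
  proof (rule order_trans[OF keys_frag_extend], rule UN_least)
    fix y assume "y \<in> Poly_Mapping.keys v"
    then have "y \<in> S"
      using assms(3) by (auto simp: free_Abelian_group_def)
    then show "Poly_Mapping.keys (frag_of (op x y)) \<subseteq> S"
      using assms(1) that by (simp add: quandle_def)
  qed
  have "Poly_Mapping.keys (quandle_ring_mult op u v) \<subseteq> S"
    unfolding quandle_ring_mult_def
  proof (rule order_trans[OF keys_frag_extend], rule UN_least)
    fix x assume "x \<in> Poly_Mapping.keys u"
    then have "x \<in> S"
      using assms(2) by (auto simp: free_Abelian_group_def)
    then show "Poly_Mapping.keys (frag_extend (\<lambda>y. frag_of (op x y)) v) \<subseteq> S"
      by (rule *)
  qed
  then show ?thesis
    by (simp add: free_Abelian_group_def)
qed

end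

theory Submission
  imports Defs "HOL-Number_Theory.Residues"
begin

text \<open>
  Write \<open>F\<close> for the discrete Fourier transform of \<open>u\<close>. The relation \<open>u\<^sup>2 = u\<close> becomes
  \<open>F k = F (2 k) * cnj (F k)\<close>, so \<open>F k \<noteq> 0\<close> forces \<open>F (2 k)\<close> to have modulus one. As \<open>n\<close> is odd,
  some iterate of doubling returns to \<open>k\<close>, hence every \<open>F k\<close> is zero or has modulus one.
  By Parseval the sum of the squares of the integer coefficients of \<open>u\<close> is at most one, so
  \<open>u\<close> is zero or plus or minus a basis element, and the sign is determined by \<open>k = 0\<close>.
\<close>

text \<open>The standard additive character of the integers mod \<open>n\<close>, lifted to all
  integers so that products such as \<open>k * x\<close> need no reduction.\<close>

definition unity_char :: "nat \<Rightarrow> int \<Rightarrow> complex" where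
  "unity_char n t = cis (2 * pi * of_int t / of_nat n)"

lemma unity_char_add: "unity_char n (s + t) = unity_char n s * unity_char n t"
  by (simp add: unity_char_def cis_mult ring_distribs add_divide_distrib)

lemma unity_char_0 [simp]: "unity_char n 0 = 1"
  by (simp add: unity_char_def)

lemma unity_char_minus: "unity_char n (- t) = cnj (unity_char n t)"
  by (simp add: unity_char_def cis_cnj)

lemma unity_char_mult_of_nat: "unity_char n (t * int k) = unity_char n t ^ k"
  by (simp add: unity_char_def Complex.DeMoivre mult_ac)

lemma unity_char_eq_1_iff:
  assumes "n > 0"
  shows "unity_char n t = 1 \<longleftrightarrow> int n dvd t"
proof
  assume "unity_char n t = 1"
  then have "cos (2 * pi * of_int t / of_nat n) = 1"
    by (simp add: unity_char_def complex_eq_iff)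
  then obtain m :: int where "2 * pi * of_int t / of_nat n = of_int m * 2 * pi"
    by (auto simp: cos_one_2pi_int)
  then have "real_of_int t = of_int (m * int n)"
    using assms by (simp add: field_simps)
  then show "int n dvd t"
    by (metis dvd_triv_right of_int_eq_iff)
next
  assume "int n dvd t"
  then obtain m where "t = int n * m" ..
  then show "unity_char n t = 1"
    using assms cis_multiple_2pi[of "of_int m"] by (simp add: unity_char_def mult.assoc)
qed

lemma unity_char_cong:
  assumes "n > 0" "[s = t] (mod int n)"
  shows "unity_char n s = unity_char n t"
proof -
  have "unity_char n (s - t) = 1"
    using assms by (simp add: unity_char_eq_1_iff cong_iff_dvd_diff)
  then show ?thesis
    using unity_char_add[of n "s - t" t] by simp
qed

text \<open>Orthogonality of characters: the sum is geometric, and its ratio is an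
  \<open>n\<close>-th root of unity that equals 1 only when \<open>n\<close> divides
  \<open>t\<close>.\<close>

lemma sum_unity_char:
  assumes "n > 0"
  shows "(\<Sum>k<n. unity_char n (t * int k)) = (if int n dvd t then of_nat n else 0)"
proof (cases "int n dvd t")
  case True
  then show ?thesis
    using assms by (simp add: unity_char_mult_of_nat unity_char_eq_1_iff[THEN iffD2])
next
  case False
  have "unity_char n t ^ n = 1"
    using assms by (simp add: unity_char_mult_of_nat[symmetric] unity_char_eq_1_iff)
  then show ?thesis
    using False assms geometric_sum[of "unity_char n t" n]
    by (simp add: unity_char_mult_of_nat unity_char_eq_1_iff)
qed

definition dft :: "nat \<Rightarrow> (int \<Rightarrow>\<^sub>0 int) \<Rightarrow> int \<Rightarrow> complex" where
  "dft n u k =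
     (\<Sum>x\<in>dihedral_carrier n. of_int (Poly_Mapping.lookup u x) * unity_char n (k * x))"

lemma finite_dihedral_carrier [simp]: "finite (dihedral_carrier n)"
  by (simp add: dihedral_carrier_def)

lemma dft_frag_of:
  assumes "x \<in> dihedral_carrier n"
  shows "dft n (frag_of x) k = unity_char n (k * x)"
  using assms by (simp add: dft_def lookup_single when_def if_distrib if_distribR cong: if_cong)

lemma dft_add: "dft n (u + v) k = dft n u k + dft n v k"
  by (simp add: dft_def lookup_add ring_distribs sum.distrib)

lemma dft_frag_cmul: "dft n (frag_cmul c u) k = of_int c * dft n u k"
  by (simp add: dft_def sum_distrib_left mult_ac)

lemma dft_sum: "dft n (\<Sum>i\<in>I. f i) k = (\<Sum>i\<in>I. dft n (f i) k)"
proof (induction I rule: infinite_finite_induct)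
qed (simp_all add: dft_add, simp_all add: dft_def)

lemma dft_frag_extend:
  assumes "Poly_Mapping.keys u \<subseteq> dihedral_carrier n"
  shows "dft n (frag_extend b u) k =
           (\<Sum>x\<in>dihedral_carrier n. of_int (Poly_Mapping.lookup u x) * dft n (b x) k)"
  unfolding frag_extend_def dft_sum dft_frag_cmul
  \<comment> \<open>\<open>frag_extend\<close> sums over the support of \<open>u\<close>; the
    further terms from the carrier have coefficient 0.\<close>
  by (rule sum.mono_neutral_left) (use assms in \<open>auto simp: in_keys_iff\<close>)

text \<open>The character of frequency \<open>k\<close> at \<open>2 * y - x\<close> splits into a
  factor in \<open>x\<close> of frequency \<open>- k\<close> and a factor in \<open>y\<close> of
  frequency \<open>2 * k\<close>, so the double sum factors.\<close>

lemma dft_quandle_ring_mult: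
  assumes "n > 0" "Poly_Mapping.keys u \<subseteq> dihedral_carrier n"
    "Poly_Mapping.keys v \<subseteq> dihedral_carrier n"
  shows "dft n (quandle_ring_mult (dihedral_op n) u v) k = dft n u (- k) * dft n v (2 * k)"
proof -
  have basis: "dft n (frag_of (dihedral_op n x y)) k =
      unity_char n (- k * x) * unity_char n (2 * k * y)" for x y
  proof -
    have "dft n (frag_of (dihedral_op n x y)) k = unity_char n (k * dihedral_op n x y)"
      using assms(1) by (intro dft_frag_of) (simp add: dihedral_op_def dihedral_carrier_def)
    also have "\<dots> = unity_char n (- k * x + 2 * k * y)"
    proof (rule unity_char_cong[OF assms(1)])
      have "[k * dihedral_op n x y = k * (2 * y - x)] (mod int n)"
        unfolding dihedral_op_def by (intro cong_mult cong_refl) (simp add: cong_def)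
      then show "[k * dihedral_op n x y = - k * x + 2 * k * y] (mod int n)"
        by (simp add: algebra_simps)
    qed
    finally show ?thesis
      by (simp only: unity_char_add)
  qed
  show ?thesis
    unfolding quandle_ring_mult_def dft_frag_extend[OF assms(2)] dft_frag_extend[OF assms(3)] basis
    unfolding dft_def sum_product unfolding sum_distrib_left by (simp add: mult_ac)
qed

text \<open>The coefficients are integers, so conjugation affects the characters only.\<close>

lemma dft_minus: "dft n u (- k) = cnj (dft n u k)"
  by (simp add: dft_def unity_char_minus)

lemma dft_cong:
  assumes "n > 0" "[j = k] (mod int n)"
  shows "dft n u j = dft n u k"
  unfolding dft_def
  by (intro sum.cong refl arg_cong2[where f = "(*)"] unity_char_cong cong_mult assms cong_refl)

text \<open>Expand each squared modulus as a double sum over \<open>x\<close> and \<open>y\<close>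
  and sum over \<open>k\<close> first: orthogonality leaves only the diagonal.\<close>

lemma parseval_dft:
  assumes "n > 0"
  shows "(\<Sum>k<n. (cmod (dft n u (int k)))\<^sup>2) =
           of_nat n * (\<Sum>x\<in>dihedral_carrier n. of_int ((Poly_Mapping.lookup u x)\<^sup>2))"
proof -
  let ?S = "dihedral_carrier n" and ?c = "\<lambda>x. complex_of_int (Poly_Mapping.lookup u x)"
  \<comment> \<open>The carrier has one representative per class, so congruent elements are
    equal.\<close>
  have diff: "int n dvd x - y \<longleftrightarrow> x = y" if "x \<in> ?S" "y \<in> ?S" for x y
    using that by (auto simp: dihedral_carrier_def mod_eq_dvd_iff[symmetric])
  have prod: "dft n u (int k) * cnj (dft n u (int k)) =
      (\<Sum>x\<in>?S. \<Sum>y\<in>?S. ?c x * ?c y * unity_char n ((x - y) * int k))" for k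
  proof -
    have "unity_char n ((x - y) * int k) =
        unity_char n (int k * x) * unity_char n (- int k * y)" for x y
      by (simp add: unity_char_add[symmetric] algebra_simps)
    then show ?thesis
      unfolding dft_minus[symmetric] by (simp add: dft_def sum_product mult_ac)
  qed
  \<comment> \<open>The computation runs in the complex numbers, where the characters live;
    injectivity of the embedding returns it to the reals.\<close>
  have "complex_of_real (\<Sum>k<n. (cmod (dft n u (int k)))\<^sup>2) =
      (\<Sum>k<n. \<Sum>x\<in>?S. \<Sum>y\<in>?S. ?c x * ?c y * unity_char n ((x - y) * int k))"
    by (simp only: of_real_sum complex_norm_square prod)
  also have "\<dots> = (\<Sum>x\<in>?S. \<Sum>k<n. \<Sum>y\<in>?S. ?c x * ?c y * unity_char n ((x - y) * int k))"
    by (rule sum.swap)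
  also have "\<dots> = (\<Sum>x\<in>?S. \<Sum>y\<in>?S. \<Sum>k<n. ?c x * ?c y * unity_char n ((x - y) * int k))"
    by (intro sum.cong refl sum.swap)
  also have "\<dots> = (\<Sum>x\<in>?S. \<Sum>y\<in>?S. if x = y then of_nat n * ?c x * ?c y else 0)"
    unfolding sum_distrib_left[symmetric] sum_unity_char[OF assms]
    by (intro sum.cong refl) (simp add: diff)
  also have "\<dots> = complex_of_real (of_nat n * (\<Sum>x\<in>?S. of_int ((Poly_Mapping.lookup u x)\<^sup>2)))"
    by (simp add: sum_distrib_left power2_eq_square mult_ac)
  finally show ?thesis
    by (simp only: of_real_eq_iff)
qed

lemma idempotent_dft:
  assumes "n > 0" "u \<in> quandle_ring_idempotents (dihedral_carrier n) (dihedral_op n)"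
  shows "dft n u k = cnj (dft n u k) * dft n u (2 * k)"
proof -
  have "Poly_Mapping.keys u \<subseteq> dihedral_carrier n"
    and "quandle_ring_mult (dihedral_op n) u u = u"
    using assms(2) by (auto simp: quandle_ring_idempotents_def free_Abelian_group_def)
  then show ?thesis
    using dft_quandle_ring_mult[OF assms(1), of u u k] by (simp add: dft_minus)
qed

lemma idempotent_norm_dft_le_1:
  assumes "odd n" "u \<in> quandle_ring_idempotents (dihedral_carrier n) (dihedral_op n)"
  shows "cmod (dft n u k) \<le> 1"
proof (cases "dft n u k = 0")
  case False
  have "n > 0"
    using assms(1) by (rule odd_pos)
  have step: "cmod (dft n u (2 * j)) = 1" if "dft n u j \<noteq> 0" for j
  proof -
    have "cmod (dft n u j) = cmod (dft n u j) * cmod (dft n u (2 * j))"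
      by (metis idempotent_dft[OF \<open>n > 0\<close> assms(2)] complex_mod_cnj norm_mult)
    then show ?thesis
      using that by simp
  qed
  \<comment> \<open>The iteration starts after one doubling: at \<open>k\<close> itself only
    nonvanishing is known so far.\<close>
  have iter: "cmod (dft n u (2 ^ Suc i * k)) = 1" for i
  proof (induction i)
    case 0
    then show ?case using step[OF False] by simp
  next
    case (Suc i)
    then show ?case using step[of "2 ^ Suc i * k"] by (force simp: mult_ac)
  qed
  \<comment> \<open>Since 2 is coprime to the odd number \<open>n\<close>, Euler's theorem brings
    \<open>k\<close> back to itself mod \<open>n\<close> after \<open>totient n\<close>
    doublings.\<close>
  have "[2 ^ totient n = 1] (mod n)"
    using assms(1) by (intro euler_theorem) simp
  then have "[2 ^ totient n = 1] (mod int n)"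
    by (metis cong_int_iff of_nat_1 of_nat_numeral of_nat_power)
  then have "[2 ^ totient n * k = 1 * k] (mod int n)"
    by (intro cong_mult cong_refl)
  \<comment> \<open>At least one doubling takes place, so \<open>iter\<close> applies.\<close>
  moreover obtain i where "totient n = Suc i"
    using \<open>n > 0\<close> by (metis gr0_implies_Suc totient_gt_0_iff)
  ultimately show ?thesis
    using iter[of i] dft_cong[OF \<open>n > 0\<close>, of "2 ^ totient n * k" k u] by simp
qed simp

text \<open>By Parseval, \<open>n\<close> times the sum of squares is a sum of \<open>n\<close>
  terms that are each at most 1.\<close>

lemma idempotent_sum_squares_le_1:
  assumes "odd n" "u \<in> quandle_ring_idempotents (dihedral_carrier n) (dihedral_op n)"
  shows "(\<Sum>x\<in>dihedral_carrier n. (Poly_Mapping.lookup u x)\<^sup>2) \<le> 1"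
proof -
  let ?s = "\<Sum>x\<in>dihedral_carrier n. (Poly_Mapping.lookup u x)\<^sup>2"
  have "n > 0"
    using assms(1) by (rule odd_pos)
  have "real n * of_int ?s = (\<Sum>k<n. (cmod (dft n u (int k)))\<^sup>2)"
    using parseval_dft[OF \<open>n > 0\<close>] by simp
  also have "\<dots> \<le> (\<Sum>k<n. 1)"
    by (intro sum_mono power_le_one idempotent_norm_dft_le_1[OF assms] norm_ge_zero)
  finally have "real n * of_int ?s \<le> real n * 1"
    by simp
  then have "real_of_int ?s \<le> 1"
    using \<open>n > 0\<close> by (simp only: mult_le_cancel_left_pos of_nat_0_less_iff)
  then show ?thesis
    by linarith
qed

lemma idempotent_zero_or_frag_of:
  assumes "odd n" "u \<in> quandle_ring_idempotents (dihedral_carrier n) (dihedral_op n)" "u \<noteq> 0"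
  shows "\<exists>x\<in>dihedral_carrier n. u = frag_of x"
proof -
  let ?S = "dihedral_carrier n" and ?c = "Poly_Mapping.lookup u"
  have "n > 0"
    using assms(1) by (rule odd_pos)
  have keys: "Poly_Mapping.keys u \<subseteq> ?S"
    using assms(2) by (auto simp: quandle_ring_idempotents_def free_Abelian_group_def)
  from \<open>u \<noteq> 0\<close> obtain x where x: "?c x \<noteq> 0"
    by (metis lookup_zero poly_mapping_eqI)
  then have "x \<in> ?S"
    using keys by (auto simp: in_keys_iff)
  \<comment> \<open>Integrality enters here: one nonzero coefficient already exhausts the bound 1,
    so all others vanish.\<close>
  have "1 \<le> (?c x)\<^sup>2"
    using x by (simp add: int_one_le_iff_zero_less)
  moreover have "(?c x)\<^sup>2 + (\<Sum>y\<in>?S - {x}. (?c y)\<^sup>2) \<le> 1"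
    using idempotent_sum_squares_le_1[OF assms(1,2)] \<open>x \<in> ?S\<close> by (simp add: sum.remove)
  moreover have "0 \<le> (\<Sum>y\<in>?S - {x}. (?c y)\<^sup>2)"
    by (simp add: sum_nonneg)
  ultimately have "(\<Sum>y\<in>?S - {x}. (?c y)\<^sup>2) = 0"
    by linarith
  then have "\<forall>y\<in>?S - {x}. (?c y)\<^sup>2 = 0"
    by (subst (asm) sum_nonneg_eq_0_iff) simp_all
  then have "?c y = 0" if "y \<noteq> x" for y
    using that keys by (cases "y \<in> ?S") (auto simp: in_keys_iff)
  then have u: "u = frag_cmul (?c x) (frag_of x)"
    by (intro poly_mapping_eqI) (auto simp: lookup_single when_def)
  \<comment> \<open>At frequency 0 the transform is the sum of the coefficients; idempotency makes
    it equal to its own square, which excludes the coefficient -1.\<close>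
  have "dft n u 0 = of_int (?c x)"
    by (subst u) (simp add: dft_frag_cmul dft_frag_of \<open>x \<in> ?S\<close>)
  then have "complex_of_int (?c x) = of_int (?c x * ?c x)"
    using idempotent_dft[OF \<open>n > 0\<close> assms(2), of 0] by simp
  then have "?c x = 1"
    using x by (simp only: of_int_eq_iff) simp
  then show ?thesis
    using u \<open>x \<in> ?S\<close> by auto
qed

theorem theorem2p5:
  fixes n :: nat
  assumes "odd n"
  shows "quandle_ring_idempotents (dihedral_carrier n) (dihedral_op n) =
           {0} \<union> {frag_of x | x. x \<in> dihedral_carrier n}"
proof
  show "quandle_ring_idempotents (dihedral_carrier n) (dihedral_op n)
      \<subseteq> {0} \<union> {frag_of x | x. x \<in> dihedral_carrier n}"
    using idempotent_zero_or_frag_of[OF assms] by blast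
  \<comment> \<open>Basis elements are idempotent because the quandle operation is.\<close>
  have "dihedral_op n x x = x" if "x \<in> dihedral_carrier n" for x
    using that by (simp add: dihedral_op_def dihedral_carrier_def)
  then show "{0} \<union> {frag_of x | x. x \<in> dihedral_carrier n}
      \<subseteq> quandle_ring_idempotents (dihedral_carrier n) (dihedral_op n)"
    by (auto simp: quandle_ring_idempotents_def free_Abelian_group_def)
       \<comment> \<open>What remains is that the product of 0 with itself is 0.\<close>
       (simp add: quandle_ring_mult_def)
qed

end
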